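(* For $S\in\mathbb C\setminus\{0,1\}$ and $T\in\mathbb C$ define $$L_1(T,S)=\begin{pmatrix}-1&\frac{S-1}{S}\\ \frac{T+S-1}{1-S}&1\end{pmatrix},\quad L_2(T,S)=\begin{pmatrix}TS&1-TS\\ S\,\frac{1+T(S-1)}{S-1}&-TS\end{pmatrix},\quad L_3(T,S)=\begin{pmatrix}1-S&-1+T\left(\frac1S-1\right)+S\\-S&S-1\end{pmatrix}.$$ Consider a hexagon of the hexagonal lattice with edges numbered cyclically $1,\dots,6$ (edges $n$ and $n+3$ being parallel, of type $n$, for $n=1,2,3$), and let $T_1,\dots,T_6\in\mathbb C\setminus\{0,1\}$ be attached to them. Then the zero curvature condition $$L_1(T_4,S)\,L_2(T_5,S)\,L_3(T_6,S)=\rho\,L_3(T_3,S)\,L_2(T_2,S)\,L_1(T_1,S)\quad\text{for all }S$$ (with a scalar $\rho\ne0$ possibly depending on $S$) is equivalent to $$\frac{T_1}{T_4}=\frac{T_3}{T_6}=\frac{T_5}{T_2}=\frac{T_1+T_3-1-T_1T_2T_3}{1-T_2}.$$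
   Context: The parameter $S$ is the spectral parameter; matrices are considered up to a scalar factor (projectively, as Möbius transformations). *)

theory Defs
  imports "HOL-Analysis.Analysis"
begin

text \<open>
  The matrices are listed by rows.  They are meaningful for \<open>S \<notin> {0, 1}\<close>; outside that range the
  divisions below are by zero.
\<close>

definition L1 :: "complex \<Rightarrow> complex \<Rightarrow> complex^2^2" where
  "L1 T S = vector [vector [- 1, (S - 1) / S],
                    vector [(T + S - 1) / (1 - S), 1]]"

definition L2 :: "complex \<Rightarrow> complex \<Rightarrow> complex^2^2" where
  "L2 T S = vector [vector [T * S, 1 - T * S],
                    vector [S * ((1 + T * (S - 1)) / (S - 1)), - (T * S)]]"

definition L3 :: "complex \<Rightarrow> complex \<Rightarrow> complex^2^2" where
  "L3 T S = vector [vector [1 - S, - 1 + T * (1 / S - 1) + S],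
                    vector [- S, S - 1]]"

text \<open>
  \<open>T1, \<dots>, T6\<close> belong to the edges of a hexagon in cyclic order, so that the edges
  \<open>n\<close> and \<open>n + 3\<close> are parallel and both carry a matrix \<open>Ln\<close>.  The factor \<open>\<rho>\<close> may depend on \<open>S\<close>.
\<close>

definition zero_curvature ::
  "complex \<Rightarrow> complex \<Rightarrow> complex \<Rightarrow> complex \<Rightarrow> complex \<Rightarrow> complex \<Rightarrow> bool" where
  "zero_curvature T1 T2 T3 T4 T5 T6 \<longleftrightarrow>
     (\<forall>S. S \<notin> {0, 1} \<longrightarrow>
        (\<exists>\<rho>. \<rho> \<noteq> 0 \<and>
             L1 T4 S ** L2 T5 S ** L3 T6 S = map_matrix ((*) \<rho>) (L3 T3 S ** L2 T2 S ** L1 T1 S)))"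

end

theory Submission
  imports Defs
begin

text \<open>
  The dependence of both products on the spectral parameter is only apparent: for \<open>S \<notin> {0, 1}\<close> they
  are the conjugates, by one and the same diagonal matrix with entries \<open>1\<close> and \<open>S / (S - 1)\<close>, of
  matrices that do not involve \<open>S\<close>
  (\<open>L1_L2_L3_eq_gauged\<close>, \<open>L3_L2_L1_eq_gauged\<close>).  Hence zero curvature says that two constant
  matrices are proportional, which is a system of four polynomial equations in \<open>T1, \<dots>, T6\<close> and one
  number \<open>\<rho>\<close> (\<open>zero_curvature_iff_constant_system\<close>).

  To solve the system, let \<open>k\<close> be the number with \<open>T1 = k T4\<close>.  Comparing the two off-diagonal
  entries gives \<open>T3 = k T6\<close>, and comparing one of them with the upper left entry gives
  \<open>T1 + T3 - 1 - T1 T2 T3 = k (1 - T2)\<close>.  What remains of the lower right entry then factors as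
  \<open>(k T2 - T5) (1 - k T4 T6) = 0\<close>.  The second factor cannot vanish: \<open>k T4 T6 = 1\<close> would
  force \<open>(T4 - 1) (T6 - 1) = 0\<close>.  So \<open>T5 = k T2\<close>.
\<close>

text \<open>
  Conjugation of a constant matrix by the diagonal matrix with entries \<open>1\<close> and \<open>S / (S - 1)\<close>, written
  out by entries so that products can be compared with it directly.
\<close>

definition gauged :: "complex \<Rightarrow> complex \<Rightarrow> complex \<Rightarrow> complex \<Rightarrow> complex \<Rightarrow> complex^2^2" where
  "gauged S a b c d = vector [vector [a, (S - 1) / S * b], vector [S / (S - 1) * c, d]]"

lemma gauged_eq_scaled_gauged_iff:
  assumes "S \<noteq> 0" "S \<noteq> 1"
  shows "gauged S a b c d = map_matrix ((*) \<rho>) (gauged S a' b' c' d') \<longleftrightarrow>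
           a = \<rho> * a' \<and> b = \<rho> * b' \<and> c = \<rho> * c' \<and> d = \<rho> * d'"
  using assms by (simp add: gauged_def map_matrix_def vec_eq_iff forall_2)

lemma L1_L2_L3_eq_gauged:
  assumes "S \<noteq> 0" "S \<noteq> 1"
  shows "L1 T4 S ** L2 T5 S ** L3 T6 S =
           gauged S (1 - T5) (T6 * (T5 - 1)) (T4 * (1 - T5)) (1 - T4 - T6 + T4 * T5 * T6)"
proof -
  \<comment> \<open>With \<open>p\<close> and \<open>q\<close> for the inverses, the entries are polynomials and the identities hold
    modulo the relations \<open>p S = 1\<close> and \<open>q (S - 1) = 1\<close>.\<close>
  define p q where "p = 1 / S" and "q = 1 / (S - 1)"
  have inv: "p * S = 1" "q * (S - 1) = 1"
    using assms by (simp_all add: p_def q_def)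
  have quot: "x / S = x * p" "x / (S - 1) = x * q" "x / (1 - S) = - (x * q)" for x
    using minus_divide_right[of x "S - 1"] by (simp_all add: p_def q_def)
  show ?thesis
    unfolding gauged_def L1_def L2_def L3_def quot
    by (simp add: matrix_matrix_mult_def vec_eq_iff forall_2 sum_2) (use inv in \<open>intro conjI; algebra\<close>)
qed

lemma L3_L2_L1_eq_gauged:
  assumes "S \<noteq> 0" "S \<noteq> 1"
  shows "L3 T3 S ** L2 T2 S ** L1 T1 S =
           gauged S (T1 + T3 - 1 - T1 * T2 * T3) (T3 * (T2 - 1)) (T1 * (1 - T2)) (T2 - 1)"
proof -
  define p q where "p = 1 / S" and "q = 1 / (S - 1)"
  have inv: "p * S = 1" "q * (S - 1) = 1"
    using assms by (simp_all add: p_def q_def)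
  have quot: "x / S = x * p" "x / (S - 1) = x * q" "x / (1 - S) = - (x * q)" for x
    using minus_divide_right[of x "S - 1"] by (simp_all add: p_def q_def)
  show ?thesis
    unfolding gauged_def L1_def L2_def L3_def quot
    by (simp add: matrix_matrix_mult_def vec_eq_iff forall_2 sum_2) (use inv in \<open>intro conjI; algebra\<close>)
qed

lemma zero_curvature_iff_constant_system:
  "zero_curvature T1 T2 T3 T4 T5 T6 \<longleftrightarrow>
     (\<exists>\<rho>. \<rho> \<noteq> 0 \<and>
        1 - T5 = \<rho> * (T1 + T3 - 1 - T1 * T2 * T3) \<and>
        T6 * (T5 - 1) = \<rho> * (T3 * (T2 - 1)) \<and>
        T4 * (1 - T5) = \<rho> * (T1 * (1 - T2)) \<and>
        1 - T4 - T6 + T4 * T5 * T6 = \<rho> * (T2 - 1))"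
    (is "_ \<longleftrightarrow> ?system")
proof -
  have two: "(2::complex) \<notin> {0, 1}" by simp
  have "zero_curvature T1 T2 T3 T4 T5 T6 \<longleftrightarrow> (\<forall>S::complex. S \<notin> {0, 1} \<longrightarrow> ?system)"
    unfolding zero_curvature_def
    by (intro all_cong1 imp_cong refl)
      (simp add: L1_L2_L3_eq_gauged L3_L2_L1_eq_gauged gauged_eq_scaled_gauged_iff)
  also have "\<dots> \<longleftrightarrow> ?system"
    \<comment> \<open>Any number outside \<open>{0, 1}\<close> shows that the quantifier over \<open>S\<close> is not vacuous.\<close>
    using two by blast
  finally show ?thesis .
qed

text \<open>
  The only step of the elimination that is not linear.  The last two hypotheses are what the diagonal
  entries of the matrix equation become after the substitution \<open>T1 = k T4\<close>, \<open>T3 = k T6\<close> and the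
  elimination of \<open>\<rho>\<close> by means of \<open>1 - T5 = \<rho> k (1 - T2)\<close>; subtracting one from the other leaves
  the product of \<open>T5 - k T2\<close> and \<open>1 - k T4 T6\<close>.
\<close>

lemma fifth_parameter_determined:
  fixes k T2 T4 T5 T6 :: complex
  assumes k: "k \<noteq> 0" and T4: "T4 \<noteq> 1" and T6: "T6 \<noteq> 1"
    and upper_left: "k * T4 + k * T6 - 1 - (k * T4) * T2 * (k * T6) = k * (1 - T2)"
    and lower_right: "k * (T4 + T6 - 1 - T4 * T5 * T6) = 1 - T5"
  shows "T5 = k * T2"
proof -
  have "(T5 - k * T2) * (1 - k * T4 * T6) = 0"
    using upper_left lower_right by algebra
  moreover have "1 - k * T4 * T6 \<noteq> 0"
  proof
    assume *: "1 - k * T4 * T6 = 0"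
    have "k * ((T4 - 1) * (T6 - 1)) = 0"
      using upper_left * by algebra
    then show False using k T4 T6 by simp
  qed
  ultimately show ?thesis by simp
qed

theorem theoremA1:
  fixes T1 T2 T3 T4 T5 T6 :: complex
  assumes "T1 \<notin> {0, 1}" and "T2 \<notin> {0, 1}" and "T3 \<notin> {0, 1}"
    and "T4 \<notin> {0, 1}" and "T5 \<notin> {0, 1}" and "T6 \<notin> {0, 1}"
  shows "zero_curvature T1 T2 T3 T4 T5 T6 \<longleftrightarrow>
           T1 / T4 = T3 / T6 \<and> T3 / T6 = T5 / T2 \<and>
           T5 / T2 = (T1 + T3 - 1 - T1 * T2 * T3) / (1 - T2)"
proof -
  define k where "k = T1 / T4"
  have k: "k \<noteq> 0" and T1: "T1 = k * T4"
    using assms by (auto simp: k_def)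
  have nz: "1 - T2 \<noteq> 0" "1 - T5 \<noteq> 0" "T2 \<noteq> 0" "T4 \<noteq> 0" "T6 \<noteq> 0"
    using assms by auto
  have ratios: "T1 / T4 = T3 / T6 \<and> T3 / T6 = T5 / T2 \<and>
           T5 / T2 = (T1 + T3 - 1 - T1 * T2 * T3) / (1 - T2) \<longleftrightarrow>
       T3 = k * T6 \<and> T5 = k * T2 \<and> T1 + T3 - 1 - T1 * T2 * T3 = k * (1 - T2)"
    (is "?ratios \<longleftrightarrow> ?solved")
  proof -
    have "?ratios \<longleftrightarrow> T3 / T6 = k \<and> T5 / T2 = k \<and>
        (T1 + T3 - 1 - T1 * T2 * T3) / (1 - T2) = k"
      unfolding k_def[symmetric] by auto
    then show ?thesis
      by (simp only: nonzero_divide_eq_eq[OF nz(5)] nonzero_divide_eq_eq[OF nz(3)]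
          nonzero_divide_eq_eq[OF nz(1)])
  qed
  show ?thesis unfolding ratios
  proof
    assume "zero_curvature T1 T2 T3 T4 T5 T6"
    then obtain \<rho> where \<rho>: "\<rho> \<noteq> 0"
      and e11: "1 - T5 = \<rho> * (T1 + T3 - 1 - T1 * T2 * T3)"
      and e12: "T6 * (T5 - 1) = \<rho> * (T3 * (T2 - 1))"
      and e21: "T4 * (1 - T5) = \<rho> * (T1 * (1 - T2))"
      and e22: "1 - T4 - T6 + T4 * T5 * T6 = \<rho> * (T2 - 1)"
      unfolding zero_curvature_iff_constant_system by blast
    have "T4 * (1 - T5) = T4 * (\<rho> * k * (1 - T2))"
      using e21 T1 by algebra
    then have T5': "1 - T5 = \<rho> * k * (1 - T2)"
      using nz by simp
    have "\<rho> * (1 - T2) * T3 = \<rho> * (1 - T2) * (k * T6)"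
      using e12 T5' by algebra
    then have T3: "T3 = k * T6"
      using \<rho> nz by simp
    have "\<rho> * (T1 + T3 - 1 - T1 * T2 * T3) = \<rho> * (k * (1 - T2))"
      using e11 T5' by algebra
    then have upper_left: "T1 + T3 - 1 - T1 * T2 * T3 = k * (1 - T2)"
      using \<rho> by simp
    have "k * (T4 + T6 - 1 - T4 * T5 * T6) = 1 - T5"
      using e22 T5' by algebra
    then have "T5 = k * T2"
      using fifth_parameter_determined k assms upper_left T1 T3 by blast
    with T3 upper_left show ?solved by blast
  next
    assume solved: ?solved
    \<comment> \<open>The value forced by the upper left entry.\<close>
    define \<rho> where "\<rho> = (1 - T5) / (k * (1 - T2))"
    have \<rho>: "\<rho> \<noteq> 0" and T5': "1 - T5 = \<rho> * (k * (1 - T2))"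
      using k nz by (auto simp: \<rho>_def)
    have "k * (1 - T4 - T6 + T4 * T5 * T6) = k * (\<rho> * (T2 - 1))"
      using solved T1 T5' by algebra
    then have e22: "1 - T4 - T6 + T4 * T5 * T6 = \<rho> * (T2 - 1)"
      using k by simp
    have "1 - T5 = \<rho> * (T1 + T3 - 1 - T1 * T2 * T3)"
      using solved T5' by metis
    moreover have "T6 * (T5 - 1) = \<rho> * (T3 * (T2 - 1))"
      using solved T5' by algebra
    moreover have "T4 * (1 - T5) = \<rho> * (T1 * (1 - T2))"
      using T1 T5' by algebra
    ultimately show "zero_curvature T1 T2 T3 T4 T5 T6"
      unfolding zero_curvature_iff_constant_system using \<rho> e22 by blast
  qed
qed

end
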